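(* Let $T$ be a tree with vertex set $\{1,\dotsc,n\}$ in which every edge $(p,q)$ carries a positive weight $w_{pq}$. For vertices $i,j$ let $d_{ij}$ be the sum of the weights of the edges on the path connecting $i$ and $j$ (with $d_{ii}=0$), let $D=[d_{ij}]$, $\eta_i=\sum_{j=1}^n d_{ij}$, $\Delta=\mathrm{Diag}(\eta_1,\dotsc,\eta_n)$, and $L_D=\Delta-D$. Then every off-diagonal entry of the Moore–Penrose inverse $L_D^{\dagger}$ is non-positive, i.e. $L_D^\dagger$ is a $\mathbf{Z}$ matrix.
   Context: A real square matrix is a $\mathbf{Z}$ matrix if all its off-diagonal entries are non-positive. $L_D$ is called the distance Laplacian of $T$. *)

theory Defs
  imports
    "HOL-Analysis.Analysis"
    "Graph_Theory.Digraph_Component"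
    "Graph_Theory.Weighted_Graph"
begin

section \<open>Weighted trees\<close>

text \<open>
  A finite simple graph is a loop-free symmetric digraph (\<^locale>\<open>pair_graph\<close>): an edge between
  \<open>p\<close> and \<open>q\<close> is represented by the two arcs \<open>(p, q)\<close> and \<open>(q, p)\<close>. In that representation the
  back-and-forth walk along one edge counts as a cycle, so the library's \<^const>\<open>tree\<close> does not
  express "connected and acyclic" for undirected graphs. The cycles of the undirected graph
  are exactly the ones of length at least 3.
\<close>

definition undirected_tree :: "'a pair_pre_digraph \<Rightarrow> bool" where
  "undirected_tree T \<longleftrightarrow>
     pair_graph T \<and> Digraph_Component.connected (with_proj T) \<and>
     \<not> (\<exists>p. pre_digraph.cycle (with_proj T) p \<and> 3 \<le> length p)"

text \<open>
  The two arcs of an edge carry the same weight.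
\<close>

definition positive_edge_weights :: "'a pair_pre_digraph \<Rightarrow> ('a \<times> 'a) weight_fun \<Rightarrow> bool" where
  "positive_edge_weights T w \<longleftrightarrow> (\<forall>(p, q) \<in> parcs T. 0 < w (p, q) \<and> w (p, q) = w (q, p))"

text \<open>
  In a tree there is exactly one path from \<open>i\<close> to \<open>j\<close>; for \<open>i = j\<close> it is the empty one, of cost 0.
\<close>

definition tree_distance :: "'a pair_pre_digraph \<Rightarrow> ('a \<times> 'a) weight_fun \<Rightarrow> 'a \<Rightarrow> 'a \<Rightarrow> real" where
  "tree_distance T w i j =
     wf_digraph.awalk_cost w (THE p. pre_digraph.apath (with_proj T) i p j)"

section \<open>Distance Laplacian\<close>

text \<open>
  The vertex set is the whole finite type \<open>'n\<close>, which also indexes rows and columns.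
\<close>

definition distance_matrix ::
    "'n::finite pair_pre_digraph \<Rightarrow> ('n \<times> 'n) weight_fun \<Rightarrow> real^'n^'n" where
  "distance_matrix T w = (\<chi> i j. tree_distance T w i j)"

definition Diag :: "('n::finite \<Rightarrow> real) \<Rightarrow> real^'n^'n" where
  "Diag \<eta> = (\<chi> i j. if i = j then \<eta> i else 0)"

definition distance_laplacian ::
    "'n::finite pair_pre_digraph \<Rightarrow> ('n \<times> 'n) weight_fun \<Rightarrow> real^'n^'n" where
  "distance_laplacian T w =
     Diag (\<lambda>i. \<Sum>j\<in>UNIV. distance_matrix T w $ i $ j) - distance_matrix T w"

section \<open>Z matrices and the Moore--Penrose inverse\<close>

definition Z_matrix :: "real^'n^'n \<Rightarrow> bool" where
  "Z_matrix A \<longleftrightarrow> (\<forall>i j. i \<noteq> j \<longrightarrow> A $ i $ j \<le> 0)"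

definition is_moore_penrose_inverse :: "real^'n^'m \<Rightarrow> real^'m^'n \<Rightarrow> bool" where
  "is_moore_penrose_inverse A X \<longleftrightarrow>
     A ** X ** A = A \<and> X ** A ** X = X \<and>
     transpose (A ** X) = A ** X \<and> transpose (X ** A) = X ** A"

definition moore_penrose_inverse :: "real^'n^'m \<Rightarrow> real^'m^'n" where
  "moore_penrose_inverse A = (THE X. is_moore_penrose_inverse A X)"

text \<open>The definite description is justified: existence and uniqueness.\<close>

lemma is_moore_penrose_inverse_unique:
  fixes A :: "real^'n^'m"
  assumes "is_moore_penrose_inverse A X" and "is_moore_penrose_inverse A Y"
  shows "X = Y"
proof -
  note X = assms(1)[unfolded is_moore_penrose_inverse_def]
  note Y = assms(2)[unfolded is_moore_penrose_inverse_def]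
  have "A ** X = transpose (A ** X)" using X by simp
  also have "\<dots> = transpose ((A ** Y) ** (A ** X))"
    using Y by (simp add: matrix_mul_assoc)
  also have "\<dots> = (A ** X) ** (A ** Y)"
    using X Y by (simp add: matrix_transpose_mul[of "A ** Y" "A ** X"])
  also have "\<dots> = A ** Y" using X by (simp add: matrix_mul_assoc)
  finally have 1: "A ** X = A ** Y" .
  have "X ** A = transpose (X ** A)" using X by simp
  also have "\<dots> = transpose ((X ** A) ** (Y ** A))"
    using Y by (metis matrix_mul_assoc)
  also have "\<dots> = (Y ** A) ** (X ** A)"
    using X Y by (simp add: matrix_transpose_mul[of "X ** A" "Y ** A"])
  also have "\<dots> = Y ** A" using X by (metis matrix_mul_assoc)
  finally have 2: "X ** A = Y ** A" .
  have "X = X ** (A ** X)" using X by (simp add: matrix_mul_assoc)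
  also have "\<dots> = Y ** A ** Y" by (metis 1 2 matrix_mul_assoc)
  finally show ?thesis using Y by simp
qed

lemma transpose_mult_self_eq_0:
  fixes N :: "real^'n^'m"
  assumes "transpose N ** N = 0"
  shows "N = 0"
proof -
  have "N $ i $ j = 0" for i j
  proof -
    have "(transpose N ** N) $ j $ j = (\<Sum>k\<in>UNIV. (N $ k $ j)\<^sup>2)"
      by (simp add: matrix_matrix_mult_def transpose_def power2_eq_square)
    then have "(\<Sum>k\<in>UNIV. (N $ k $ j)\<^sup>2) = 0" using assms by simp
    then show ?thesis by (simp add: sum_nonneg_eq_0_iff)
  qed
  then show ?thesis by (simp add: vec_eq_iff)
qed

lemma transpose_diff: "transpose (A - B) = transpose A - transpose (B :: real^'n^'m)"
  by (simp add: transpose_def vec_eq_iff)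

lemma matrix_mul_diff_left: "(A - B) ** C = A ** C - B ** (C :: real^'n^'m)"
  by (simp add: matrix_matrix_mult_def vec_eq_iff left_diff_distrib sum_subtractf)

lemma matrix_mul_diff_right: "A ** (B - C) = A ** B - A ** (C :: real^'n^'m)"
  by (simp add: matrix_matrix_mult_def vec_eq_iff right_diff_distrib sum_subtractf)

lemma ex_inner_inverse:
  fixes M :: "real^'n^'m"
  shows "\<exists>G :: real^'m^'n. M ** G ** M = M"
proof -
  have "\<exists>g. range g \<subseteq> UNIV \<and> linear g \<and> (\<forall>x\<in>range ((*v) M). M *v g x = x)"
    by (rule real_vector.linear_exists_right_inverse_on) auto
  then obtain g where "linear g" and g: "\<And>x. M *v g (M *v x) = M *v x" by auto
  then have "M ** matrix g ** M = M"
    by (simp add: matrix_eq matrix_vector_mul_assoc[symmetric] matrix_works)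
  then show ?thesis ..
qed

lemma ex_symmetric_inner_inverse:
  fixes A :: "real^'n^'m"
  shows "\<exists>Y :: real^'m^'n. A ** Y ** A = A \<and> transpose (A ** Y) = A ** Y"
proof -
  let ?B = "transpose A ** A"
  obtain G where G: "?B ** G ** ?B = ?B" using ex_inner_inverse by blast
  have tB: "transpose ?B = ?B" by (simp add: matrix_transpose_mul)
  have G': "?B ** transpose G ** ?B = ?B"
    using arg_cong[OF G, of transpose] tB by (metis matrix_mul_assoc matrix_transpose_mul)
  let ?P = "A ** G ** transpose A"
  let ?N = "?P ** A - A"
  have "transpose ?N ** ?N
      = ?B ** transpose G ** ?B ** G ** ?B - ?B ** transpose G ** ?B - ?B ** G ** ?B + ?B"
    by (simp add: transpose_diff matrix_transpose_mul matrix_mul_assoc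
        matrix_mul_diff_left matrix_mul_diff_right)
  also have "\<dots> = 0" by (simp only: G G') simp
  finally have PA: "?P ** A = A" using transpose_mult_self_eq_0 by fastforce
  have tP: "transpose ?P = A ** transpose G ** transpose A"
    by (simp add: matrix_transpose_mul matrix_mul_assoc)
  have "?P ** transpose ?P = transpose ?P" unfolding tP by (metis PA matrix_mul_assoc)
  then have "transpose ?P = ?P" by (metis matrix_transpose_mul transpose_transpose)
  with PA show ?thesis by (intro exI[of _ "G ** transpose A"]) (simp add: matrix_mul_assoc)
qed

lemma is_moore_penrose_inverse_exists:
  fixes A :: "real^'n^'m"
  shows "\<exists>X. is_moore_penrose_inverse A X"
proof -
  obtain Y where Y: "A ** Y ** A = A" "transpose (A ** Y) = A ** Y"
    using ex_symmetric_inner_inverse by blast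
  obtain Z where Z: "transpose A ** Z ** transpose A = transpose A"
      "transpose (transpose A ** Z) = transpose A ** Z"
    using ex_symmetric_inner_inverse by blast
  define W where "W = transpose Z"
  have W: "A ** W ** A = A" "transpose (W ** A) = W ** A"
    using arg_cong[OF Z(1), of transpose] Z(2)
    by (auto simp: W_def matrix_transpose_mul matrix_mul_assoc)
  let ?X = "W ** A ** Y"
  have AX: "A ** ?X = A ** Y" and XA: "?X ** A = W ** A"
    using W(1) Y(1) by (metis matrix_mul_assoc)+
  have "?X ** A ** ?X = ?X" unfolding XA by (metis W(1) matrix_mul_assoc)
  then show ?thesis
    unfolding is_moore_penrose_inverse_def by (metis AX XA W(2) Y)
qed

lemma moore_penrose_inverse: "is_moore_penrose_inverse A (moore_penrose_inverse A)"
  unfolding moore_penrose_inverse_def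
  by (rule theI') (use is_moore_penrose_inverse_exists is_moore_penrose_inverse_unique in blast)

end

theory Submission
  imports Defs
begin

text \<open>
  Let \<open>L\<close> be the Laplacian of \<open>T\<close> in which the edge \<open>(p, q)\<close> has conductance \<open>1 / w (p, q)\<close>. Only one
  neighbour of \<open>i\<close> is closer to \<open>j \<noteq> i\<close> than \<open>i\<close> itself, hence the Graham--Lovasz identity
  \<open>L D = \<tau> 1\<^sup>T - 2 I\<close>, where \<open>\<tau> i = 2 - deg i\<close>. The kernel of \<open>L_D\<close> consists of the constant
  vectors, so \<open>X = L_D\<^sup>\<dagger>\<close> satisfies \<open>L_D X = I - J / n\<close> and \<open>1\<^sup>T X = 0\<close>. Multiplying by \<open>L\<close> gives
  \<open>(L \<Delta> + 2 I) X = L\<close>. For a column \<open>x\<close> of \<open>X\<close> with index \<open>j\<close>, the vector \<open>z = e\<^sub>j - \<Delta> x\<close> therefore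
  solves \<open>L z + 2 \<Delta>\<^sup>-\<^sup>1 z = 2 \<Delta>\<^sup>-\<^sup>1 e\<^sub>j \<ge> 0\<close>, and the minimum principle yields \<open>z \<ge> 0\<close>, that is,
  \<open>x i \<le> 0\<close> for \<open>i \<noteq> j\<close>.
\<close>

section \<open>Minimum principles\<close>

lemma finite_type_minimizer:
  fixes f :: "'n::finite \<Rightarrow> real"
  obtains m where "\<And>i. f m \<le> f i"
proof -
  have "Min (range f) \<in> range f" by (rule Min_in) auto
  then obtain m where m: "f m = Min (range f)" by (metis imageE)
  have "f m \<le> f i" for i unfolding m by simp
  then show ?thesis using that by blast
qed

text \<open>At a minimizer \<open>m\<close> every summand \<open>c m k * (z m - z k)\<close> is
  non-positive, so \<open>super\<close> forces \<open>0 \<le> a m * z m\<close>.\<close>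

lemma laplacian_minimum_principle:
  fixes z :: "'n::finite \<Rightarrow> real"
  assumes c: "\<And>i k. 0 \<le> c i k" and a: "\<And>i. 0 < a i"
    and super: "\<And>i. 0 \<le> (\<Sum>k\<in>UNIV. c i k * (z i - z k)) + a i * z i"
  shows "0 \<le> z i"
proof -
  obtain m where m: "\<And>i. z m \<le> z i" using finite_type_minimizer by blast
  have "(\<Sum>k\<in>UNIV. c m k * (z m - z k)) \<le> 0"
    using c m by (intro sum_nonpos) (simp add: mult_nonneg_nonpos)
  then have "0 \<le> a m * z m" using super[of m] by linarith
  then have "0 \<le> z m" using a[of m] by (simp add: zero_le_mult_iff)
  then show ?thesis using m order_trans by blast
qed

text \<open>At a minimizer of \<open>v\<close> all summands have one sign, so each vanishes, and
  positivity of \<open>d\<close> off the diagonal gives equality with the minimum.\<close>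

lemma laplacian_kernel_constant:
  fixes v :: "'n::finite \<Rightarrow> real"
  assumes d: "\<And>i k. i \<noteq> k \<Longrightarrow> 0 < d i k"
    and ker: "\<And>i. (\<Sum>k\<in>UNIV. d i k * (v i - v k)) = 0"
  shows "v i = v j"
proof -
  obtain m where m: "\<And>i. v m \<le> v i" using finite_type_minimizer by blast
  have "v k = v m" for k
  proof (cases "k = m")
    case False
    have nonneg: "0 \<le> d m k * (v k - v m)" for k
      using d[of m k] m[of k] by (cases "k = m") auto
    have "(\<Sum>k\<in>UNIV. d m k * (v k - v m)) = 0"
      using ker[of m] by (simp add: sum_negf[symmetric] algebra_simps sum_subtractf)
    then have "d m k * (v k - v m) = 0"
      using nonneg by (simp add: sum_nonneg_eq_0_iff)
    then show ?thesis using d[of m k] False by simp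
  qed simp
  then show ?thesis by metis
qed

section \<open>Moore--Penrose inverses of Laplacians\<close>

text \<open>With \<open>X\<close> the inverse, \<open>mat 1 - A ** X\<close> is the orthogonal
  projection onto the kernel, the constant vectors, so its entries agree. The columns of
  \<open>X\<close> lie in the range of \<open>A\<close>, which is orthogonal to the
  constants.\<close>

lemma symmetric_laplacian_moore_penrose:
  fixes A :: "real^'n^'n"
  assumes sym: "transpose A = A" and ann: "A *v 1 = 0"
    and ker: "\<And>v i k. A *v v = 0 \<Longrightarrow> v $ i = v $ k"
  obtains \<gamma> where "A ** moore_penrose_inverse A = mat 1 - (\<chi> i j. \<gamma>)"
    and "\<And>j. (\<Sum>i\<in>UNIV. moore_penrose_inverse A $ i $ j) = 0"
proof -
  define X where "X = moore_penrose_inverse A"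
  have X: "A ** X ** A = A" "X ** A ** X = X"
    "transpose (A ** X) = A ** X" "transpose (X ** A) = X ** A"
    using moore_penrose_inverse[of A] by (simp_all add: is_moore_penrose_inverse_def X_def)
  define P where "P = mat 1 - A ** X"
  have tP: "transpose P = P" using X(3) by (simp add: P_def transpose_diff)
  have "P ** A = 0" using X(1) by (simp add: P_def matrix_mul_diff_left)
  moreover have "A ** P = transpose (P ** A)" by (simp add: matrix_transpose_mul sym tP)
  ultimately have AP: "A ** P = 0" by (simp add: transpose_def vec_eq_iff)
  have col: "P $ i $ j = P $ k $ j" for i j k
  proof -
    have "A *v column j P = 0"
      using AP by (simp add: vec_eq_iff matrix_vector_mult_def column_def matrix_matrix_mult_def)
    from ker[OF this, of i k] show ?thesis by (simp add: column_def)
  qed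
  have symP: "P $ i $ j = P $ j $ i" for i j
    using arg_cong[OF tP, of "\<lambda>M. M $ i $ j"] by (simp add: transpose_def)
  have const: "P $ i $ j = P $ k $ l" for i j k l
    using col symP by metis
  \<comment> \<open>All entries of \<open>P\<close> coincide, so any pair of indices serves.\<close>
  define \<gamma> where "\<gamma> = P $ undefined $ undefined"
  have "P = (\<chi> i j. \<gamma>)"
    unfolding \<gamma>_def vec_eq_iff using const by simp
  moreover have "A ** X = mat 1 - P" by (simp add: P_def)
  ultimately have 1: "A ** X = mat 1 - (\<chi> i j. \<gamma>)" by simp
  \<comment> \<open>Symmetry of \<open>X ** A\<close> turns \<open>X ** A ** X = X\<close> into a
    factorization of \<open>X\<close> with \<open>A\<close> on the left.\<close>
  have "A ** transpose X = X ** A" using X(4) sym by (simp add: matrix_transpose_mul)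
  then have XA: "X = A ** (transpose X ** X)" using X(2) by (simp add: matrix_mul_assoc)
  have colsum: "(\<Sum>i\<in>UNIV. A $ i $ k) = 0" for k
  proof -
    have "(\<Sum>i\<in>UNIV. transpose A $ k $ i) = 0"
      unfolding sym using arg_cong[OF ann, of "\<lambda>v. v $ k"] by (simp add: matrix_vector_mult_def)
    then show ?thesis by (simp add: transpose_def)
  qed
  have 2: "(\<Sum>i\<in>UNIV. X $ i $ j) = 0" for j
  proof -
    have "(\<Sum>i\<in>UNIV. X $ i $ j) = (\<Sum>i\<in>UNIV. \<Sum>k\<in>UNIV. A $ i $ k * (transpose X ** X) $ k $ j)"
      by (subst XA) (simp add: matrix_matrix_mult_def)
    also have "\<dots> = (\<Sum>k\<in>UNIV. (\<Sum>i\<in>UNIV. A $ i $ k) * (transpose X ** X) $ k $ j)"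
      by (subst sum.swap) (simp add: sum_distrib_right)
    finally show ?thesis by (simp add: colsum)
  qed
  show ?thesis using that 1 2 unfolding X_def by blast
qed

text \<open>The linear algebra without the tree: \<open>GL\<close> is the Graham--Lovasz identity,
  read entrywise, for the Laplacian with conductances \<open>c\<close>.\<close>

lemma Z_matrix_moore_penrose_distance_type:
  fixes D :: "real^'n^'n"
  assumes sym: "\<And>i j. D $ i $ j = D $ j $ i"
    and diag: "\<And>i. D $ i $ i = 0"
    and pos: "\<And>i j. i \<noteq> j \<Longrightarrow> 0 < D $ i $ j"
    and c: "\<And>i k. 0 \<le> c i k"
    and GL: "\<And>i j. (\<Sum>k\<in>UNIV. c i k * (D $ i $ j - D $ k $ j)) = \<tau> i - (if i = j then 2 else 0)"
  shows "Z_matrix (moore_penrose_inverse (Diag (\<lambda>i. \<Sum>j\<in>UNIV. D $ i $ j) - D))"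
  unfolding Z_matrix_def
proof (intro allI impI)
  define \<eta> where "\<eta> i = (\<Sum>j\<in>UNIV. D $ i $ j)" for i
  define A where "A = Diag \<eta> - D"
  define X where "X = moore_penrose_inverse A"
  have Diag_mult: "(\<Sum>k\<in>UNIV. Diag \<eta> $ i $ k * v k) = \<eta> i * v i" for i v
    by (simp add: Diag_def if_distrib[of "\<lambda>x. x * _"] cong: if_cong)
  have A_mult: "(\<Sum>k\<in>UNIV. A $ i $ k * v k) = \<eta> i * v i - (\<Sum>k\<in>UNIV. D $ i $ k * v k)" for i v
    by (simp add: A_def left_diff_distrib sum_subtractf Diag_mult)
  have "transpose A = A"
    using sym by (auto simp: A_def Diag_def transpose_def vec_eq_iff)
  moreover have "A *v 1 = 0"
    using A_mult[of _ "\<lambda>_. 1"] by (simp add: vec_eq_iff matrix_vector_mult_def \<eta>_def)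
  \<comment> \<open>\<open>A\<close> is the Laplacian of the complete graph with weights
    \<open>D\<close>, which are positive off the diagonal.\<close>
  moreover have "v $ i = v $ k" if "A *v v = 0" for v i k
  proof (rule laplacian_kernel_constant[where d = "\<lambda>i k. D $ i $ k"])
    fix i
    have "(\<Sum>k\<in>UNIV. A $ i $ k * v $ k) = 0"
      using arg_cong[OF that, of "\<lambda>u. u $ i"] by (simp add: matrix_vector_mult_def)
    then show "(\<Sum>k\<in>UNIV. D $ i $ k * (v $ i - v $ k)) = 0"
      unfolding A_mult by (simp add: \<eta>_def right_diff_distrib sum_subtractf sum_distrib_right)
  qed (rule pos)
  ultimately obtain \<gamma> where AX: "A ** X = mat 1 - (\<chi> i j. \<gamma>)"
    and sumX: "\<And>j. (\<Sum>i\<in>UNIV. X $ i $ j) = 0"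
    unfolding X_def using symmetric_laplacian_moore_penrose by blast
  fix i j :: 'n
  assume "i \<noteq> j"
  define x where "x i = X $ i $ j" for i
  define \<delta> :: "'n \<Rightarrow> real" where "\<delta> i = (if i = j then 1 else 0)" for i
  define z where "z i = \<delta> i - \<eta> i * x i" for i
  have sumx: "(\<Sum>i\<in>UNIV. x i) = 0" using sumX by (simp add: x_def)
  \<comment> \<open>Column \<open>j\<close> of \<open>AX\<close> trades the product with
    \<open>\<eta>\<close> for one with \<open>D\<close>, to which \<open>GL\<close> applies.\<close>
  have z: "z i = \<gamma> - (\<Sum>m\<in>UNIV. D $ i $ m * x m)" for i
  proof -
    have "(\<Sum>k\<in>UNIV. A $ i $ k * x k) = \<delta> i - \<gamma>"
      using arg_cong[OF AX, of "\<lambda>M. M $ i $ j"]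
      by (simp add: matrix_matrix_mult_def x_def \<delta>_def mat_def)
    then show ?thesis by (simp add: A_mult z_def)
  qed
  \<comment> \<open>The constant \<open>\<gamma>\<close> cancels in the differences, and the
    \<open>\<tau>\<close> term left by \<open>GL\<close> carries the factor \<open>sumx\<close>,
    which is zero.\<close>
  have Lz: "(\<Sum>k\<in>UNIV. c i k * (z i - z k)) = 2 * x i" for i
  proof -
    have "(\<Sum>k\<in>UNIV. c i k * (z i - z k))
        = - (\<Sum>k\<in>UNIV. \<Sum>m\<in>UNIV. c i k * (D $ i $ m - D $ k $ m) * x m)"
      unfolding z sum_negf[symmetric]
      by (rule sum.cong) (simp_all add: sum_subtractf[symmetric] sum_distrib_left algebra_simps)
    also have "\<dots> = - (\<Sum>m\<in>UNIV. (\<tau> i - (if i = m then 2 else 0)) * x m)"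
      by (subst sum.swap) (simp add: sum_distrib_right[symmetric] GL)
    also have "\<dots> = 2 * x i - \<tau> i * (\<Sum>m\<in>UNIV. x m)"
      by (simp add: left_diff_distrib sum_subtractf sum_distrib_left
          if_distrib[of "\<lambda>x. x * _"] cong: if_cong)
    finally show ?thesis by (simp add: sumx)
  qed
  \<comment> \<open>Positivity takes a second index, supplied by
    \<open>i \<noteq> j\<close>.\<close>
  have \<eta>: "0 < \<eta> k" for k
  proof -
    obtain l where "l \<noteq> k" using \<open>i \<noteq> j\<close> by metis
    moreover have "0 \<le> D $ k $ m" for m using pos[of k m] diag[of k] by (cases "k = m") auto
    ultimately show ?thesis
      unfolding \<eta>_def by (intro sum_pos2[of _ l]) (auto intro: pos)
  qed
  have "0 \<le> z i"
  \<comment> \<open>The choice of \<open>a\<close> comes from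
    \<open>2 * x k = 2 / \<eta> k * (\<delta> k - z k)\<close>.\<close>
  proof (rule laplacian_minimum_principle[where c = c and a = "\<lambda>i. 2 / \<eta> i"])
    fix k
    have "(\<Sum>l\<in>UNIV. c k l * (z k - z l)) + 2 / \<eta> k * z k = 2 / \<eta> k * \<delta> k"
      unfolding Lz using \<eta>[of k] by (simp add: z_def field_simps)
    then show "0 \<le> (\<Sum>l\<in>UNIV. c k l * (z k - z l)) + 2 / \<eta> k * z k"
      using \<eta>[of k] by (simp add: \<delta>_def)
  qed (use c \<eta> in auto)
  then have "\<eta> i * x i \<le> 0" using \<open>i \<noteq> j\<close> by (simp add: z_def \<delta>_def)
  then show "moore_penrose_inverse (Diag (\<lambda>i. \<Sum>j\<in>UNIV. D $ i $ j) - D) $ i $ j \<le> 0"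
    using \<eta>[of i] by (simp add: mult_le_0_iff x_def X_def A_def \<eta>_def[abs_def])
qed

section \<open>Distances in weighted trees\<close>

locale weighted_tree = pair_graph T
  for T :: "'a pair_pre_digraph" +
  fixes w :: "('a \<times> 'a) weight_fun"
  assumes tree_connected: "Digraph_Component.connected (with_proj T)"
    and acyclic: "\<And>p. cycle p \<Longrightarrow> length p < 3"
    and weight_pos: "(p, q) \<in> parcs T \<Longrightarrow> 0 < w (p, q)"
    and weight_sym: "(p, q) \<in> parcs T \<Longrightarrow> w (p, q) = w (q, p)"
begin

text \<open>If two paths to \<open>v\<close> leave \<open>u\<close> towards different neighbours,
  going along one and back along the other joins these neighbours while avoiding \<open>u\<close>;
  closing up through \<open>u\<close> gives a forbidden cycle.\<close>

lemma apath_unique: "apath u p v \<Longrightarrow> apath u p' v \<Longrightarrow> p = p'"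
proof (induction p arbitrary: u p')
  case Nil
  then show ?case
    by (cases p') (auto simp: apath_Nil_iff apath_Cons_iff apath_def awalk_verts_conv awalk_conv)
next
  case (Cons e p)
  obtain a where e: "e = (u, a)" "(u, a) \<in> parcs T" "apath a p v" "u \<notin> set (pawalk_verts a p)"
    using Cons.prems(1) by (cases e) (auto simp: apath_Cons_iff)
  have "v \<in> set (pawalk_verts a p)"
    using e(3) unfolding apath_def by (metis awalkE awalk_verts_non_Nil last_in_set)
  then have "u \<noteq> v" using e(4) by blast
  then obtain b q where p': "p' = (u, b) # q" "(u, b) \<in> parcs T" "apath b q v"
    "u \<notin> set (pawalk_verts b q)"
    using Cons.prems(2) by (cases p') (auto simp: apath_Cons_iff apath_Nil_iff)
  show ?case
  proof (cases "a = b")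
    case True
    then show ?thesis using Cons.IH e p' by auto
  next
    case False
    have walks: "awalk a p v" "awalk v (rev_path q) b"
      using e p' by (auto simp: apath_def)
    have wk: "awalk a (p @ rev_path q) b" using walks by auto
    have u: "u \<notin> set (pawalk_verts a (p @ rev_path q))"
      using e p' walks by (auto simp: set_awalk_verts_append awalk_verts_rev_path apath_def)
    \<comment> \<open>The concatenation may repeat vertices. Cutting it down to a path keeps only
      some of its arcs, so \<open>u\<close> is still avoided.\<close>
    define r where "r = awalk_to_apath (p @ rev_path q)"
    have r: "apath a r b" unfolding r_def by (rule apath_awalk_to_apath[OF wk])
    have sub: "set r \<subseteq> set (p @ rev_path q)" unfolding r_def by (rule awalk_to_apath_subset[OF wk])
    have "r \<noteq> []" using r False by (auto simp: apath_Nil_iff)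
    then have "p @ rev_path q \<noteq> []" using sub by auto
    have "awalk a r b" using r unfolding apath_def by blast
    have "set (pawalk_verts a r) \<subseteq> set (pawalk_verts a (p @ rev_path q))"
      unfolding set_awalk_verts_not_Nil[OF wk \<open>p @ rev_path q \<noteq> []\<close>]
        set_awalk_verts_not_Nil[OF \<open>awalk a r b\<close> \<open>r \<noteq> []\<close>] set_map
      by (intro Un_mono image_mono sub)
    then have ur: "u \<notin> set (pawalk_verts a r)" using u by blast
    let ?c = "(u, a) # r @ [(b, u)]"
    have bu: "(b, u) \<in> parcs T" using p' arcs_symmetric by blast
    have "awalk u ?c u"
      using e r bu by (auto simp: awalk_Cons_iff apath_def awalk_Nil_iff dest: in_arcsD1)
    moreover have "pawalk_verts a (r @ [(b, u)]) = pawalk_verts a r @ [u]"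
      using r by (subst awalk_verts_append[of _ _ _ u])
        (use bu in \<open>auto simp: apath_def awalk_Cons_iff awalk_Nil_iff dest: in_arcsD2\<close>)
    ultimately have "cycle ?c"
      using ur r unfolding cycle_def by (intro exI[of _ u]) (auto simp: apath_def)
    then have "length ?c < 3" by (rule acyclic)
    \<comment> \<open>Since \<open>r\<close> is nonempty, \<open>?c\<close> has at least three
      arcs.\<close>
    then show ?thesis using \<open>r \<noteq> []\<close> by (cases r) auto
  qed
qed

section \<open>Tree distance: positivity, symmetry and change across an edge\<close>

abbreviation dist\<^sub>T :: "'a \<Rightarrow> 'a \<Rightarrow> real" where
  "dist\<^sub>T \<equiv> tree_distance T w"

lemma tree_distance_apath:
  assumes "apath u p v"
  shows "dist\<^sub>T u v = awalk_cost w p"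
  unfolding tree_distance_def
  using assms apath_unique by (metis the_equality)

lemma tree_apath_exists:
  assumes "u \<in> pverts T" "v \<in> pverts T"
  obtains p where "apath u p v"
proof -
  have "u \<rightarrow>\<^sup>*\<^bsub>with_proj T\<^esub> v"
    using symmetric_connected_imp_strongly_connected[OF pair_sym_arcs tree_connected] assms
    by (auto simp: strongly_connected_def)
  then show ?thesis using that by (auto simp: reachable_apath)
qed

lemma awalk_cost_pos:
  assumes "awalk u p v" "p \<noteq> []"
  shows "0 < awalk_cost w p"
  using assms
proof (induction p arbitrary: u)
  case (Cons e p)
  then have "0 \<le> awalk_cost w p" by (cases p) (auto simp: awalk_Cons_iff intro: less_imp_le)
  then show ?case using Cons.prems weight_pos by (cases e) (fastforce simp: awalk_Cons_iff)
qed simp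

lemma awalk_cost_rev_path:
  "awalk u p v \<Longrightarrow> awalk_cost w (rev_path p) = awalk_cost w p"
  by (induction p arbitrary: u) (auto simp: awalk_Cons_iff weight_sym[symmetric])

lemma tree_distance_self:
  "u \<in> pverts T \<Longrightarrow> dist\<^sub>T u u = 0"
  using tree_distance_apath[of u "[]" u] by (simp add: apath_Nil_iff)

lemma tree_distance_sym:
  assumes "u \<in> pverts T" "v \<in> pverts T"
  shows "dist\<^sub>T u v = dist\<^sub>T v u"
proof -
  obtain p where p: "apath u p v" using tree_apath_exists assms .
  then have "awalk_cost w (rev_path p) = awalk_cost w p"
    unfolding apath_def by (blast intro: awalk_cost_rev_path)
  moreover have "apath v (rev_path p) u" using p by simp
  ultimately show ?thesis using tree_distance_apath[OF p] tree_distance_apath by metis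
qed

lemma tree_distance_pos:
  assumes "u \<in> pverts T" "v \<in> pverts T" "u \<noteq> v"
  shows "0 < dist\<^sub>T u v"
proof -
  obtain p where p: "apath u p v" using tree_apath_exists assms(1,2) .
  then have "p \<noteq> []" using assms(3) by (auto simp: apath_Nil_iff)
  then show ?thesis using p awalk_cost_pos by (auto simp: tree_distance_apath apath_def)
qed

text \<open>Here \<open>a\<close> follows \<open>u\<close> on the path to \<open>v\<close>; from any
  other neighbour \<open>b\<close>, the path to \<open>v\<close> starts with the arc to
  \<open>u\<close>.\<close>

lemma tree_distance_step:
  assumes "u \<in> pverts T" "v \<in> pverts T" "u \<noteq> v"
  obtains a where "(u, a) \<in> parcs T" "dist\<^sub>T u v - dist\<^sub>T a v = w (u, a)"
    and "\<And>b. (u, b) \<in> parcs T \<Longrightarrow> b \<noteq> a \<Longrightarrow> dist\<^sub>T u v - dist\<^sub>T b v = - w (u, b)"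
proof -
  obtain p where p: "apath u p v" using tree_apath_exists assms(1,2) .
  then obtain a q where q: "p = (u, a) # q" "(u, a) \<in> parcs T" "apath a q v"
    using assms(3) by (cases p) (auto simp: apath_Cons_iff apath_Nil_iff)
  have "dist\<^sub>T u v - dist\<^sub>T b v = - w (u, b)" if b: "(u, b) \<in> parcs T" "b \<noteq> a" for b
  proof -
    \<comment> \<open>Otherwise uniqueness makes the piece of \<open>p\<close> up to
      \<open>b\<close> the single arc \<open>(u, b)\<close>, yet \<open>p\<close> starts with
      \<open>(u, a)\<close>.\<close>
    have "b \<notin> set (pawalk_verts u p)"
    proof
      assume "b \<in> set (pawalk_verts u p)"
      then obtain r s where rs: "p = r @ s" "awalk u r b"
        using awalk_decomp[of u p v b] p by (auto simp: apath_def)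
      then have "apath u r b" using p by (auto simp: apath_append_iff)
      moreover have "apath u [(u, b)] b"
        using b no_loops' by (auto simp: apath_Cons_iff apath_Nil_iff dest: in_arcsD2)
      ultimately have "r = [(u, b)]" by (rule apath_unique)
      then show False using rs q b by simp
    qed
    then have "apath b ((b, u) # p) v"
      using p b arcs_symmetric by (auto simp: apath_Cons_iff)
    then show ?thesis
      using tree_distance_apath[OF p] tree_distance_apath[of b "(b, u) # p" v] weight_sym[OF b(1)]
      by simp
  qed
  moreover have "dist\<^sub>T u v - dist\<^sub>T a v = w (u, a)"
    using tree_distance_apath[OF p] tree_distance_apath[OF q(3)] q(1) by simp
  ultimately show ?thesis using that q(2) by blast
qed

text \<open>Division by the weight leaves 1 or -1 for each neighbour. If
  \<open>u \<noteq> v\<close>, exactly one neighbour is closer to \<open>v\<close> and gives 1; if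
  \<open>u = v\<close>, all give -1.\<close>

lemma graham_lovasz:
  assumes "u \<in> pverts T" "v \<in> pverts T"
  shows "(\<Sum>a | (u, a) \<in> parcs T. (dist\<^sub>T u v - dist\<^sub>T a v) / w (u, a))
    = 2 - real (card {a. (u, a) \<in> parcs T}) - (if u = v then 2 else 0)"
proof -
  let ?N = "{a. (u, a) \<in> parcs T}"
  have fin: "finite ?N"
    by (rule finite_subset[OF _ pair_finite_verts]) (auto dest: in_arcsD2)
  show ?thesis
  proof (cases "u = v")
    case True
    have "(dist\<^sub>T u v - dist\<^sub>T a v) / w (u, a) = -1" if a: "a \<in> ?N" for a
    proof -
      have "apath a [(a, u)] u"
        using a arcs_symmetric no_loops' by (auto simp: apath_Cons_iff apath_Nil_iff assms)
      then have "dist\<^sub>T a u = w (a, u)" using tree_distance_apath by fastforce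
      then show ?thesis
        using True tree_distance_self[OF assms(1)] weight_pos weight_sym a by fastforce
    qed
    then show ?thesis using True by simp
  next
    case False
    obtain a where a: "(u, a) \<in> parcs T" "dist\<^sub>T u v - dist\<^sub>T a v = w (u, a)"
      and other: "\<And>b. (u, b) \<in> parcs T \<Longrightarrow> b \<noteq> a \<Longrightarrow> dist\<^sub>T u v - dist\<^sub>T b v = - w (u, b)"
      using tree_distance_step[OF assms False] by blast
    have "(dist\<^sub>T u v - dist\<^sub>T b v) / w (u, b) = (if b = a then 2 else 0) - 1" if "b \<in> ?N" for b
      using that a(2) other[of b] weight_pos[of u b] by auto
    then have "(\<Sum>b\<in>?N. (dist\<^sub>T u v - dist\<^sub>T b v) / w (u, b))
        = (\<Sum>b\<in>?N. (if b = a then 2 else 0) - 1)"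
      by (intro sum.cong) auto
    also have "\<dots> = 2 - real (card ?N)"
      using fin a(1) by (simp add: sum_subtractf)
    finally show ?thesis using False by simp
  qed
qed

end

theorem theorem3p20:
  fixes T :: "'n::finite pair_pre_digraph"
    and w :: "('n \<times> 'n) weight_fun"
  assumes "undirected_tree T"
    and "pverts T = UNIV"
    and "positive_edge_weights T w"
  shows "Z_matrix (moore_penrose_inverse (distance_laplacian T w))"
proof -
  interpret pair_graph T using assms(1) by (simp add: undirected_tree_def)
  interpret weighted_tree T w
    using assms(1,3)
    by unfold_locales (auto simp: undirected_tree_def positive_edge_weights_def not_le[symmetric])
  \<comment> \<open>Extension by zero turns sums over neighbours into sums over all
    vertices.\<close>
  define c where "c i k = (if (i, k) \<in> parcs T then 1 / w (i, k) else 0)" for i k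
  show ?thesis
    unfolding distance_laplacian_def
  proof (rule Z_matrix_moore_penrose_distance_type[where c = c
        and \<tau> = "\<lambda>i. 2 - real (card {a. (i, a) \<in> parcs T})"])
    fix i j
    have "(\<Sum>k\<in>UNIV. c i k * (tree_distance T w i j - tree_distance T w k j))
        = (\<Sum>k | (i, k) \<in> parcs T. (tree_distance T w i j - tree_distance T w k j) / w (i, k))"
      by (rule sum.mono_neutral_cong_right) (auto simp: c_def)
    then show "(\<Sum>k\<in>UNIV. c i k * (distance_matrix T w $ i $ j - distance_matrix T w $ k $ j))
        = 2 - real (card {a. (i, a) \<in> parcs T}) - (if i = j then 2 else 0)"
      using graham_lovasz[of i j] assms(2) by (simp add: distance_matrix_def)
  next
    show "0 \<le> c i k" for i k using weight_pos[of i k] by (auto simp: c_def)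
  qed (use assms(2) tree_distance_self tree_distance_pos tree_distance_sym
      in \<open>auto simp: distance_matrix_def\<close>)
qed

end
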